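(* Let $a\geq 2$ be an integer, set $e=a^2-1$, and define $p_j,q_j\in\mathbb{Z}_{\geq 0}$ by $$p_j+q_j\sqrt{e}=(a+\sqrt{e})^j\qquad(j\in\mathbb{Z}_{\geq 0}).$$ Fix $n\in\mathbb{Z}_{>0}$. Define $$\gamma_e(Z)=\frac{eZ(Z^2-1)}{6}\in\mathbb{Q}[Z].$$ Then the following two statements hold. (1) For every positive odd integer $k$, one has $q_n\mid q_{nk}$ in $\mathbb{Z}$ and $$\frac{q_{nk}}{q_n}\equiv k+\gamma_e(k)q_n^2\pmod{q_n^4},$$ where $\gamma_e(k)\in\mathbb{Z}_{\geq 0}$. In particular, $\frac{q_{nk}}{q_n}\equiv k\pmod{q_n^2}$. (2) Let $s\in\mathbb{Z}\setminus\{0\}$ satisfy $s\mid q_n$ in $\mathbb{Z}$, let $t\in\mathbb{Z}$ be odd, fix $\varepsilon\in\{\pm 1\}$, and fix a residue class $c\pmod{s}$. Then there exist infinitely many $r\in\mathbb{Z}$ such that $k:=t+rq_n^2$ is a positive odd integer and, with $$\lambda_k:=\frac{q_{nk}}{q_n}\in\mathbb{Z}_{>0}\quad\text{and}\quad x:=\varepsilon\,\frac{\lambda_k-t}{q_n^2}=\varepsilon\left(\frac{\lambda_k-k}{q_n^2}+r\right)\in\mathbb{Z},$$ one has $x\equiv c\pmod{s}$.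
   Context: All objects are introduced in the claim. *)

theory Defs
  imports Complex_Main "HOL-Computational_Algebra.Polynomial" "HOL-Number_Theory.Cong"
begin

definition gamma_poly :: "int \<Rightarrow> rat poly" where
  "gamma_poly e = smult (of_int e / 6) ([:0, 1:] * ([:0, 1:]\<^sup>2 - 1))"

lemma poly_gamma_poly: "poly (gamma_poly e) z = of_int e * z * (z\<^sup>2 - 1) / 6"
  by (simp add: gamma_poly_def)

text \<open>Sequences of nonnegative integers with \<open>p j + q j * sqrt e = (a + sqrt e) ^ j\<close> do exist;
  they are unique because \<open>a\<^sup>2 - 1\<close> is not a square for \<open>a \<ge> 2\<close>.\<close>

lemma solution_sequences_exist:
  fixes a e :: int
  assumes "a \<ge> 2" and "e = a\<^sup>2 - 1"
  shows "\<exists>p q :: nat \<Rightarrow> int. \<forall>j. p j \<ge> 0 \<and> q j \<ge> 0 \<and>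
    real_of_int (p j) + real_of_int (q j) * sqrt (real_of_int e)
      = (real_of_int a + sqrt (real_of_int e)) ^ j"
proof -
  have e: "e \<ge> 0"
    using assms power_mono[of 2 a 2] by simp
  have "\<exists>x y :: int. x \<ge> 0 \<and> y \<ge> 0 \<and>
    real_of_int x + real_of_int y * sqrt (real_of_int e)
      = (real_of_int a + sqrt (real_of_int e)) ^ j" for j :: nat
  proof (induction j)
    case 0
    show ?case
      by (rule exI[of _ 1], rule exI[of _ 0]) simp
  next
    case (Suc j)
    then obtain x y :: int where xy: "x \<ge> 0" "y \<ge> 0"
      "real_of_int x + real_of_int y * sqrt (real_of_int e)
        = (real_of_int a + sqrt (real_of_int e)) ^ j"
      by blast
    have sq: "sqrt (real_of_int e) * sqrt (real_of_int e) = real_of_int e"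
      using e by simp
    have "(real_of_int a + sqrt (real_of_int e)) ^ Suc j
      = (real_of_int a + sqrt (real_of_int e)) * (real_of_int x + real_of_int y * sqrt (real_of_int e))"
      using xy(3) by simp
    also have "\<dots> = real_of_int a * real_of_int x
        + real_of_int y * (sqrt (real_of_int e) * sqrt (real_of_int e))
        + (real_of_int a * real_of_int y + real_of_int x) * sqrt (real_of_int e)"
      by (simp add: algebra_simps)
    also have "\<dots> = real_of_int (a * x + y * e)
        + real_of_int (a * y + x) * sqrt (real_of_int e)"
      unfolding sq by simp
    finally show ?case
      using xy(1,2) assms(1) e
      by (intro exI[of _ "a * x + y * e"] exI[of _ "a * y + x"]) simp
  qed
  then show ?thesis
    by metis
qed

end

theory Submission imports Defs begin

text \<open>
  Put \<open>Q = q n\<close> and \<open>P = p n\<close>, so \<open>P\<^sup>2 = 1 + e Q\<^sup>2\<close>. Passing from \<open>k\<close> to \<open>k + 2\<close> multiplies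
  \<open>p (n k) + q (n k) \<surd>e\<close> by \<open>(1 + 2 e Q\<^sup>2) + 2 P Q \<surd>e\<close>, so for odd \<open>k\<close> the quotients
  \<open>q (n k) / Q\<close> and \<open>p (n k) / P\<close> satisfy a recursion in \<open>Q\<^sup>2\<close> alone, and its solution is read off
  modulo \<open>Q ^ 4\<close>. For the second statement, \<open>k = t + r Q\<^sup>2\<close> gives \<open>x \<equiv> \<epsilon> (r + \<gamma> k)\<close> modulo \<open>s\<close>,
  and \<open>\<gamma> k \<equiv> \<gamma> t\<close> modulo \<open>Q\<close>, the denominator 6 of \<open>\<gamma>\<close> being harmless. Hence
  it suffices that \<open>r \<equiv> \<epsilon> c - \<gamma> t\<close> modulo \<open>s\<close>.
\<close>

section \<open>Irrationality of the square root of \<open>e\<close> and uniqueness of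
  coordinates\<close>

text \<open>For \<open>a \<ge> 2\<close> the number \<open>a^2 - 1\<close> lies strictly between the
  consecutive squares \<open>(a - 1)^2\<close> and \<open>a^2\<close>.\<close>

lemma minus_one_not_square:
  fixes a z :: int
  assumes "a \<ge> 2"
  shows "z\<^sup>2 \<noteq> a\<^sup>2 - 1"
proof
  assume eq: "z\<^sup>2 = a\<^sup>2 - 1"
  have "\<bar>z\<bar> < a"
    using eq assms by (intro power_less_imp_less_base[of "\<bar>z\<bar>" 2 a]) auto
  then have "\<bar>z\<bar>\<^sup>2 \<le> (a - 1)\<^sup>2"
    by (intro power_mono) auto
  then show False
    using eq assms by (simp add: power2_eq_square algebra_simps)
qed

text \<open>Isolating the root and squaring gives \<open>(x - x')^2 = (y' - y)^2 * e\<close>; if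
  \<open>y' \<noteq> y\<close>, then \<open>y' - y\<close> divides \<open>x - x'\<close> and
  \<open>e\<close> would be a square.\<close>

lemma sqrt_independent:
  fixes a e x y x' y' :: int
  assumes a: "a \<ge> 2" and e: "e = a\<^sup>2 - 1"
    and eq: "real_of_int x + real_of_int y * sqrt (real_of_int e)
      = real_of_int x' + real_of_int y' * sqrt (real_of_int e)"
  shows "x = x' \<and> y = y'"
proof -
  have e0: "e \<ge> 0"
    using a e power_mono[of 2 a 2] by simp
  have "real_of_int (x - x') = real_of_int (y' - y) * sqrt (real_of_int e)"
    using eq by (simp add: algebra_simps)
  then have "(real_of_int (x - x'))\<^sup>2 = (real_of_int (y' - y))\<^sup>2 * real_of_int e"
    using e0 by (simp add: power_mult_distrib)
  then have sq: "(x - x')\<^sup>2 = (y' - y)\<^sup>2 * e"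
    by (metis of_int_eq_iff of_int_mult of_int_power)
  have "y' - y = 0"
  proof (rule ccontr)
    assume nz: "y' - y \<noteq> 0"
    have "(y' - y)\<^sup>2 dvd (x - x')\<^sup>2"
      using sq by simp
    then obtain z where "x - x' = (y' - y) * z"
      using pow_divides_pow_iff[of 2 "y' - y" "x - x'"] by auto
    then have "z\<^sup>2 = e"
      using sq nz by (simp add: power_mult_distrib)
    then show False
      using minus_one_not_square[OF a] e by blast
  qed
  then show ?thesis
    using sq by simp
qed

section \<open>Integrality of gamma and its dependence on \<open>k\<close> modulo
  \<open>Q\<close>\<close>

lemma six_dvd_cube_minus_self: "6 dvd k * (k\<^sup>2 - 1)" for k :: int
proof -
  have "k mod 6 \<in> {0, 1, 2, 3, 4, 5}"
    by auto
  then have "(k mod 6) * ((k mod 6)\<^sup>2 - 1) mod 6 = 0"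
    by auto
  moreover have "[(k mod 6) * ((k mod 6)\<^sup>2 - 1) = k * (k\<^sup>2 - 1)] (mod 6)"
    by (intro cong_mult cong_diff cong_pow cong_refl) simp_all
  ultimately show ?thesis
    by (simp add: cong_def mod_eq_0_iff_dvd)
qed

text \<open>Here \<open>g\<close> is the value of gamma at \<open>k\<close>. Characterising it by an
  equation for \<open>6 * g\<close> keeps the later computations inside the integers.\<close>

lemma gamma_integral:
  fixes e k :: int
  obtains g where "6 * g = e * k * (k\<^sup>2 - 1)"
  using six_dvd_cube_minus_self[of k] by (metis dvd_def dvd_mult mult.assoc)

lemma poly_gamma_poly_eqI:
  assumes "6 * g = e * k * (k\<^sup>2 - 1)"
  shows "of_int g = poly (gamma_poly e) (of_int k)"
proof -
  have "(6 :: rat) * of_int g = of_int e * of_int k * ((of_int k)\<^sup>2 - 1)"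
    using arg_cong[OF assms, of "of_int :: int \<Rightarrow> rat"] by simp
  then show ?thesis
    by (simp add: poly_gamma_poly)
qed

text \<open>The difference \<open>6 * (g - h)\<close> contains the factor
  \<open>k - t = r * Q^2\<close>. The 2 in 6 cancels against the cofactor
  \<open>k^2 + k * t + t^2 - 1\<close>, which is even because \<open>k\<close> and \<open>t\<close>
  are odd.\<close>

lemma gamma_congruent:
  fixes e k t r Q g h :: int
  assumes g: "6 * g = e * k * (k\<^sup>2 - 1)" and h: "6 * h = e * t * (t\<^sup>2 - 1)"
    and k: "k = t + r * Q\<^sup>2" and odd: "odd k" "odd t"
  shows "Q dvd g - h"
proof -
  have "even (k\<^sup>2 + k * t + t\<^sup>2 - 1)"
    using odd by simp
  then obtain M where M: "k\<^sup>2 + k * t + t\<^sup>2 - 1 = 2 * M"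
    by blast
  have "6 * (g - h) = e * (k - t) * (k\<^sup>2 + k * t + t\<^sup>2 - 1)"
    using g h by algebra
  then have *: "3 * (g - h) = Q * (e * r * Q * M)"
    unfolding M using k by algebra
  show ?thesis
  \<comment> \<open>It remains to cancel the 3: if it divides \<open>Q\<close>, the second factor
    \<open>Q\<close> absorbs it and the first survives; otherwise it is coprime to
    \<open>Q\<close>.\<close>
  proof (cases "3 dvd Q")
    case True
    then obtain w where w: "Q = 3 * w"
      by blast
    have "g - h = Q * (e * r * w * M)"
      using * w by simp
    then show ?thesis
      by simp
  next
    case False
    have "prime (3 :: int)"
      by simp
    then have "coprime Q 3"
      using False prime_imp_coprime coprime_commute by blast
    then show ?thesis
      using * by (metis coprime_dvd_mult_right_iff dvd_triv_left)
  qed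
qed

section \<open>Addition formulas, Pell equation and positivity\<close>

locale pell_sequences =
  fixes a e :: int and p q :: "nat \<Rightarrow> int"
  assumes a_ge_2: "a \<ge> 2"
    and e_def: "e = a\<^sup>2 - 1"
    and p_nonneg: "p j \<ge> 0"
    and q_nonneg: "q j \<ge> 0"
    and pq_power: "real_of_int (p j) + real_of_int (q j) * sqrt (real_of_int e)
      = (real_of_int a + sqrt (real_of_int e)) ^ j"
begin

lemma e_pos: "e > 0"
  using a_ge_2 e_def power_mono[of 2 a 2] by simp

text \<open>Uniqueness of coordinates lets \<open>p j\<close> and \<open>q j\<close> be read off
  from any integer expression of the power; the initial values and the addition formulas are
  obtained in this way.\<close>

lemma pq_eqI:
  assumes "real_of_int x + real_of_int y * sqrt (real_of_int e)
    = (real_of_int a + sqrt (real_of_int e)) ^ j"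
  shows "p j = x" "q j = y"
  using sqrt_independent[OF a_ge_2 e_def, of "p j" "q j" x y] assms pq_power by auto

lemma pq_0: "p 0 = 1" "q 0 = 0"
  by (rule pq_eqI[of 1 0 0]; simp)+

lemma pq_1: "p (Suc 0) = a" "q (Suc 0) = 1"
  by (rule pq_eqI[of a 1 "Suc 0"]; simp)+

lemma pq_add: "p (i + j) = p i * p j + e * q i * q j" "q (i + j) = p i * q j + q i * p j"
proof -
  have sq: "sqrt (real_of_int e) * sqrt (real_of_int e) = real_of_int e"
    using e_pos by simp
  have "real_of_int (p i * p j + e * q i * q j)
      + real_of_int (p i * q j + q i * p j) * sqrt (real_of_int e)
    = real_of_int (p i * p j)
      + (sqrt (real_of_int e) * sqrt (real_of_int e)) * real_of_int (q i * q j)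
      + real_of_int (p i * q j + q i * p j) * sqrt (real_of_int e)"
    unfolding sq by simp
  also have "\<dots> = (real_of_int (p i) + real_of_int (q i) * sqrt (real_of_int e))
      * (real_of_int (p j) + real_of_int (q j) * sqrt (real_of_int e))"
    by (simp add: algebra_simps)
  also have "\<dots> = (real_of_int a + sqrt (real_of_int e)) ^ (i + j)"
    by (simp add: pq_power power_add)
  finally show "p (i + j) = p i * p j + e * q i * q j" "q (i + j) = p i * q j + q i * p j"
    by (rule pq_eqI)+
qed

text \<open>The base \<open>a + sqrt e\<close> has norm \<open>a^2 - e = 1\<close>, and the norm is
  multiplicative; the induction carries this out one factor at a time.\<close>

lemma pell_equation: "(p j)\<^sup>2 = 1 + e * (q j)\<^sup>2"
proof (induction j)
  case 0
  show ?case
    by (simp add: pq_0)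
next
  case (Suc j)
  have "p (Suc j) = p j * a + e * q j" "q (Suc j) = p j + q j * a"
    using pq_add[of j "Suc 0"] by (simp_all add: pq_1)
  then show ?case
    using Suc e_def by algebra
qed

lemma p_pos: "p j > 0"
proof -
  have "p j \<noteq> 0"
  proof
    assume "p j = 0"
    then have "1 + e * (q j)\<^sup>2 = 0"
      using pell_equation[of j] by simp
    moreover have "e * (q j)\<^sup>2 \<ge> 0"
      using e_pos by simp
    ultimately show False
      by linarith
  qed
  then show ?thesis
    using p_nonneg[of j] by simp
qed

lemma q_pos:
  assumes "j > 0"
  shows "q j > 0"
proof -
  obtain i where "j = Suc i"
    using assms gr0_implies_Suc by blast
  then have "q j = p i + q i * a"
    using pq_add(2)[of i "Suc 0"] by (simp add: pq_1)
  moreover have "q i * a \<ge> 0"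
    using q_nonneg a_ge_2 by simp
  ultimately show ?thesis
    using p_pos[of i] by linarith
qed

section \<open>Expansion at odd multiples modulo the fourth power of \<open>q n\<close>\<close>

text \<open>The recursion couples the quotients \<open>A\<close> and \<open>B\<close>, and the
  \<open>(q n)^2\<close> coefficient of \<open>B\<close> feeds into that of the next
  \<open>A\<close>, so both are carried through the induction. The witnesses \<open>h\<close> and
  \<open>h'\<close> turn the congruences modulo \<open>(q n)^4\<close> into exact
  identities.\<close>

lemma odd_multiple_expansion:
  "\<exists>A B g h h'. q (n * (2 * m + 1)) = q n * A \<and> p (n * (2 * m + 1)) = p n * B \<and>
    6 * g = e * (2 * int m + 1) * ((2 * int m + 1)\<^sup>2 - 1) \<and>
    A = (2 * int m + 1) + g * (q n)\<^sup>2 + h * (q n) ^ 4 \<and>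
    B = 1 + 2 * e * int m * (int m + 1) * (q n)\<^sup>2 + h' * (q n) ^ 4"
proof (induction m)
  case 0
  show ?case
    by (intro exI[of _ 1] exI[of _ 0]) simp
next
  case (Suc m)
  define P Q M where "P = p n" and "Q = q n" and "M = int m"
  obtain A B g h h' where IH:
    "q (n * (2 * m + 1)) = Q * A" "p (n * (2 * m + 1)) = P * B"
    "6 * g = e * (2 * M + 1) * ((2 * M + 1)\<^sup>2 - 1)"
    "A = (2 * M + 1) + g * Q\<^sup>2 + h * Q ^ 4"
    "B = 1 + 2 * e * M * (M + 1) * Q\<^sup>2 + h' * Q ^ 4"
    using Suc unfolding P_def Q_def M_def by blast
  have pell: "P\<^sup>2 = 1 + e * Q\<^sup>2"
    unfolding P_def Q_def by (rule pell_equation)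
  have double: "p (n + n) = 1 + 2 * e * Q\<^sup>2" "q (n + n) = 2 * P * Q"
    using pell pq_add[of n n] unfolding P_def Q_def by (simp_all add: power2_eq_square)
  have idx: "n * (2 * Suc m + 1) = n * (2 * m + 1) + (n + n)"
    by (simp add: algebra_simps)
  \<comment> \<open>\<open>A'\<close> and \<open>B'\<close> come from the addition formulas with
    increment \<open>n + n\<close>, after removing \<open>Q\<close> and \<open>P\<close>; the Pell
    equation replaces the \<open>P^2\<close> in \<open>A'\<close>. The increment
    \<open>4 * e * (M + 1)^2\<close> is the difference of gamma at \<open>2 * M + 3\<close> and at
    \<open>2 * M + 1\<close>.\<close>
  define A' B' g' where "A' = 2 * (1 + e * Q\<^sup>2) * B + A * (1 + 2 * e * Q\<^sup>2)"
    and "B' = B * (1 + 2 * e * Q\<^sup>2) + 2 * e * Q\<^sup>2 * A"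
    and "g' = g + 4 * e * (M + 1)\<^sup>2"
  have "q (n * (2 * Suc m + 1)) = P * B * (2 * P * Q) + Q * A * (1 + 2 * e * Q\<^sup>2)"
    unfolding idx pq_add[of _ "n + n"] double IH(1,2) by simp
  also have "\<dots> = Q * A'"
    using pell unfolding A'_def by algebra
  finally have q': "q (n * (2 * Suc m + 1)) = Q * A'" .
  have "p (n * (2 * Suc m + 1)) = P * B * (1 + 2 * e * Q\<^sup>2) + e * (Q * A) * (2 * P * Q)"
    unfolding idx pq_add[of _ "n + n"] double IH(1,2) by simp
  also have "\<dots> = P * B'"
    unfolding B'_def by algebra
  finally have p': "p (n * (2 * Suc m + 1)) = P * B'" .
  have g': "6 * g' = e * (2 * (M + 1) + 1) * ((2 * (M + 1) + 1)\<^sup>2 - 1)"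
    unfolding g'_def using IH(3) by algebra
  \<comment> \<open>The long cofactors of \<open>Q ^ 4\<close> here and for \<open>B'\<close>
    collect all terms of degree at least 4 in \<open>Q\<close>; they are the next \<open>h\<close>
    and \<open>h'\<close>.\<close>
  have A': "A' = (2 * (M + 1) + 1) + g' * Q\<^sup>2
      + (2 * h' + h + 2 * e * (g + 2 * e * M * (M + 1)) + 2 * e * (h + h') * Q\<^sup>2) * Q ^ 4"
    unfolding A'_def g'_def IH(4,5) by algebra
  have B': "B' = 1 + 2 * e * (M + 1) * ((M + 1) + 1) * Q\<^sup>2
      + (h' + 4 * e\<^sup>2 * M * (M + 1) + 2 * e * g + 2 * e * (h + h') * Q\<^sup>2) * Q ^ 4"
    unfolding B'_def IH(4,5) by algebra
  have M: "int (Suc m) = M + 1"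
    by (simp add: M_def)
  show ?case
    unfolding M P_def[symmetric] Q_def[symmetric]
    using q' p' g' A' B' by blast
qed

lemma odd_multiple_quotient:
  assumes "n > 0" and "odd k"
  obtains l g h where "q (n * k) = q n * l" "l > 0"
    "6 * g = e * int k * ((int k)\<^sup>2 - 1)" "l = int k + g * (q n)\<^sup>2 + h * (q n) ^ 4"
proof -
  obtain m where m: "k = 2 * m + 1"
    using assms(2) oddE by blast
  then have k: "2 * int m + 1 = int k"
    by simp
  obtain l g h where *: "q (n * k) = q n * l" "6 * g = e * int k * ((int k)\<^sup>2 - 1)"
    "l = int k + g * (q n)\<^sup>2 + h * (q n) ^ 4"
    using odd_multiple_expansion[of n m] unfolding k m[symmetric] by blast
  have "q (n * k) > 0" "q n > 0"
    using assms by (auto intro!: q_pos simp: odd_pos)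
  then have "l > 0"
    using *(1) by (simp add: zero_less_mult_iff)
  with * show ?thesis
    using that by blast
qed

text \<open>These are reductions of the exact expansion; gamma is nonnegative at \<open>k\<close>
  because \<open>k \<ge> 1\<close> and \<open>e > 0\<close>.\<close>

lemma odd_multiple_congruences:
  assumes "n > 0" and "odd k"
  shows "q n dvd q (n * k)"
    and "\<exists>g::int. g \<ge> 0 \<and> of_int g = poly (gamma_poly e) (of_nat k) \<and>
      [q (n * k) div q n = int k + g * (q n)\<^sup>2] (mod (q n) ^ 4)"
    and "[q (n * k) div q n = int k] (mod (q n)\<^sup>2)"
proof -
  obtain l g h where *: "q (n * k) = q n * l"
    "6 * g = e * int k * ((int k)\<^sup>2 - 1)" "l = int k + g * (q n)\<^sup>2 + h * (q n) ^ 4"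
    using odd_multiple_quotient[OF assms] by metis
  have l: "q (n * k) div q n = l"
    using *(1) q_pos[OF assms(1)] by simp
  show "q n dvd q (n * k)"
    using *(1) by simp
  have "int k \<ge> 1"
    using assms(2) by (simp add: Suc_le_eq odd_pos)
  then have "e * int k * ((int k)\<^sup>2 - 1) \<ge> 0"
    using e_pos by (intro mult_nonneg_nonneg) auto
  then have "g \<ge> 0"
    using *(2) by linarith
  moreover have "of_int g = poly (gamma_poly e) (of_nat k)"
    using poly_gamma_poly_eqI[OF *(2)] by simp
  moreover have "[l = int k + g * (q n)\<^sup>2] (mod (q n) ^ 4)"
    using *(3) by (simp add: cong_iff_dvd_diff)
  ultimately show "\<exists>g::int. g \<ge> 0 \<and> of_int g = poly (gamma_poly e) (of_nat k) \<and>
      [q (n * k) div q n = int k + g * (q n)\<^sup>2] (mod (q n) ^ 4)"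
    unfolding l by blast
  have "l - int k = (q n)\<^sup>2 * (g + h * (q n)\<^sup>2)"
    using *(3) by algebra
  then show "[q (n * k) div q n = int k] (mod (q n)\<^sup>2)"
    unfolding l cong_iff_dvd_diff by simp
qed

section \<open>Prescribing the residue of \<open>x\<close> modulo \<open>s\<close>\<close>

text \<open>Dividing the expansion by \<open>(q n)^2\<close> shows that \<open>x\<close> is
  \<epsilon> times \<open>r + g\<close> modulo \<open>s\<close>, as \<open>s\<close> divides
  \<open>q n\<close>. Replacing \<open>g\<close> by the value \<open>h\<close> of gamma at
  \<open>t\<close>, which does not depend on \<open>r\<close>, makes the condition on
  \<open>r\<close> a single congruence.\<close>

lemma quotient_in_residue_class:
  fixes s t \<epsilon> c r h :: int
  assumes n: "n > 0" and s: "s dvd q n" and t: "odd t" and \<epsilon>: "\<epsilon> \<in> {1, -1}"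
    and h: "6 * h = e * t * (t\<^sup>2 - 1)" and r: "[r = \<epsilon> * c - h] (mod s)"
    and pos: "t + r * (q n)\<^sup>2 > 0" and odd: "odd (t + r * (q n)\<^sup>2)"
  shows "\<exists>(k::nat) (l::int) (x::int).
    int k = t + r * (q n)\<^sup>2 \<and> k > 0 \<and> odd k \<and>
    of_int l = (of_int (q (n * k)) / of_int (q n) :: rat) \<and> l > 0 \<and>
    of_int x = (of_int \<epsilon> * ((of_int l - of_int t) / of_int ((q n)\<^sup>2)) :: rat) \<and>
    of_int x = (of_int \<epsilon> * ((of_int l - of_nat k) / of_int ((q n)\<^sup>2) + of_int r) :: rat) \<and>
    [x = c] (mod s)"
proof -
  define k where "k = nat (t + r * (q n)\<^sup>2)"
  have k: "int k = t + r * (q n)\<^sup>2"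
    using pos by (simp add: k_def)
  have k_odd: "odd (int k)"
    unfolding k by (fact odd)
  then have k_pos: "k > 0" "odd k"
    by (simp_all add: odd_pos)
  obtain l g w where l: "q (n * k) = q n * l" "l > 0"
    "6 * g = e * int k * ((int k)\<^sup>2 - 1)" "l = int k + g * (q n)\<^sup>2 + w * (q n) ^ 4"
    using odd_multiple_quotient[OF n k_pos(2)] by metis
  define x where "x = \<epsilon> * (r + g + w * (q n)\<^sup>2)"
  have Q: "(of_int (q n) :: rat) \<noteq> 0"
    using q_pos[OF n] by simp
  have x1: "l - t = (q n)\<^sup>2 * (r + g + w * (q n)\<^sup>2)"
    using l(4) k by algebra
  have x2: "l - int k = (q n)\<^sup>2 * (g + w * (q n)\<^sup>2)"
    using l(4) by algebra
  have "(of_int l - of_int t :: rat) = of_int ((q n)\<^sup>2 * (r + g + w * (q n)\<^sup>2))"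
    using x1 by (metis of_int_diff)
  then have X1: "of_int x = (of_int \<epsilon> * ((of_int l - of_int t) / of_int ((q n)\<^sup>2)) :: rat)"
    using Q by (simp add: x_def)
  have "(of_int l - of_nat k :: rat) = of_int ((q n)\<^sup>2 * (g + w * (q n)\<^sup>2))"
    using x2 by (metis of_int_diff of_int_of_nat_eq)
  then have "(of_int l - of_nat k) / of_int ((q n)\<^sup>2)
      = (of_int (g + w * (q n)\<^sup>2) :: rat)"
    using Q by simp
  then have X2: "of_int x
      = (of_int \<epsilon> * ((of_int l - of_nat k) / of_int ((q n)\<^sup>2) + of_int r) :: rat)"
    by (simp only: x_def of_int_mult of_int_add add_ac)
  have "s dvd g - h"
    using gamma_congruent[OF l(3) h k k_odd t] s by (rule dvd_trans[rotated])
  moreover have "s dvd r - (\<epsilon> * c - h)"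
    using r by (simp add: cong_iff_dvd_diff)
  moreover have "s dvd (q n)\<^sup>2"
    using s by (simp add: power2_eq_square)
  ultimately have "s dvd \<epsilon> * ((r - (\<epsilon> * c - h)) + (g - h) + w * (q n)\<^sup>2)"
    by (intro dvd_mult dvd_add)
  \<comment> \<open>The two occurrences of \<open>h\<close> cancel, and
    \<open>\<epsilon> * \<epsilon> = 1\<close> leaves exactly \<open>c\<close>.\<close>
  also have "\<epsilon> * ((r - (\<epsilon> * c - h)) + (g - h) + w * (q n)\<^sup>2) = x - c"
    using \<epsilon> by (auto simp: x_def)
  finally have "[x = c] (mod s)"
    by (simp add: cong_iff_dvd_diff)
  moreover have "of_int l = (of_int (q (n * k)) / of_int (q n) :: rat)"
    using l(1) Q by simp
  ultimately show ?thesis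
    using k k_pos l(2) X1 X2 by blast
qed

end

theorem proposition2p4:
  fixes a e :: int and p q :: "nat \<Rightarrow> int" and n :: nat
  assumes "a \<ge> 2"
    and "e = a\<^sup>2 - 1"
    and "\<And>j. p j \<ge> 0"
    and "\<And>j. q j \<ge> 0"
    and "\<And>j. real_of_int (p j) + real_of_int (q j) * sqrt (real_of_int e)
                = (real_of_int a + sqrt (real_of_int e)) ^ j"
    and "n > 0"
  shows
    "(\<forall>k::nat. k > 0 \<and> odd k \<longrightarrow>
        q n dvd q (n * k) \<and>
        (\<exists>g::int. g \<ge> 0 \<and> of_int g = poly (gamma_poly e) (of_nat k) \<and>
           [q (n * k) div q n = int k + g * (q n)\<^sup>2] (mod (q n) ^ 4)) \<and>
        [q (n * k) div q n = int k] (mod (q n)\<^sup>2))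
     \<and>
     (\<forall>(s::int) (t::int) (\<epsilon>::int) (c::int).
        s \<noteq> 0 \<and> s dvd q n \<and> odd t \<and> \<epsilon> \<in> {1, -1} \<longrightarrow>
        infinite {r::int. \<exists>(k::nat) (l::int) (x::int).
          int k = t + r * (q n)\<^sup>2 \<and> k > 0 \<and> odd k \<and>
          of_int l = (of_int (q (n * k)) / of_int (q n) :: rat) \<and> l > 0 \<and>
          of_int x = (of_int \<epsilon> * ((of_int l - of_int t) / of_int ((q n)\<^sup>2)) :: rat) \<and>
          of_int x = (of_int \<epsilon> * ((of_int l - of_nat k) / of_int ((q n)\<^sup>2) + of_int r) :: rat) \<and>
          [x = c] (mod s)})"
proof -
  interpret pell_sequences a e p q
    using assms(1-5) by unfold_locales
  show ?thesis
  proof (intro conjI allI impI; (elim conjE)?)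
    fix k :: nat
    assume "odd k"
    note * = odd_multiple_congruences[OF \<open>n > 0\<close> \<open>odd k\<close>]
    show "q n dvd q (n * k)"
      by (fact *)
    show "\<exists>g::int. g \<ge> 0 \<and> of_int g = poly (gamma_poly e) (of_nat k) \<and>
        [q (n * k) div q n = int k + g * (q n)\<^sup>2] (mod (q n) ^ 4)"
      by (fact *)
    show "[q (n * k) div q n = int k] (mod (q n)\<^sup>2)"
      by (fact *)
  next
    fix s t \<epsilon> c :: int
    assume s: "s \<noteq> 0" "s dvd q n" and t: "odd t" and \<epsilon>: "\<epsilon> \<in> {1, -1}"
    obtain h where h: "6 * h = e * t * (t\<^sup>2 - 1)"
      by (rule gamma_integral)
    \<comment> \<open>The factor \<open>1 + s\<close> makes \<open>r * (q n)\<^sup>2\<close> even: if \<open>q n\<close> is odd, so is \<open>s\<close>.\<close>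
    define b where "b = (\<epsilon> * c - h) * (1 + s)"
    \<comment> \<open>Adding multiples of \<open>2 * \<bar>s\<bar>\<close> preserves both the
      residue of \<open>b\<close> modulo \<open>s\<close> and its parity. The summands
      \<open>\<bar>b\<bar> + \<bar>t\<bar> + 1\<close> force \<open>f i > \<bar>t\<bar>\<close>,
      which makes \<open>k\<close> positive, and \<open>int i\<close> makes the values
      distinct.\<close>
    define f where "f i = b + 2 * \<bar>s\<bar> * (\<bar>b\<bar> + \<bar>t\<bar> + 1 + int i)" for i :: nat
    have "inj f"
      using s(1) by (auto simp: inj_def f_def)
    then have "infinite (range f)"
      using finite_imageD infinite_UNIV_nat by blast
    moreover have "range f \<subseteq> {r::int. \<exists>(k::nat) (l::int) (x::int).
          int k = t + r * (q n)\<^sup>2 \<and> k > 0 \<and> odd k \<and>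
          of_int l = (of_int (q (n * k)) / of_int (q n) :: rat) \<and> l > 0 \<and>
          of_int x = (of_int \<epsilon> * ((of_int l - of_int t) / of_int ((q n)\<^sup>2)) :: rat) \<and>
          of_int x = (of_int \<epsilon> * ((of_int l - of_nat k) / of_int ((q n)\<^sup>2) + of_int r) :: rat) \<and>
          [x = c] (mod s)}"
    proof (intro image_subsetI CollectI quotient_in_residue_class[OF \<open>n > 0\<close> s(2) t \<epsilon> h])
      fix i :: nat
      have "f i - (\<epsilon> * c - h) = s * (\<epsilon> * c - h) + \<bar>s\<bar> * (2 * (\<bar>b\<bar> + \<bar>t\<bar> + 1 + int i))"
        by (simp add: f_def b_def algebra_simps)
      also have "s dvd \<dots>"
        by (intro dvd_add dvd_mult2) simp_all
      finally show "[f i = \<epsilon> * c - h] (mod s)"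
        by (simp add: cong_iff_dvd_diff)
      have "1 * (\<bar>b\<bar> + \<bar>t\<bar> + 1 + int i) \<le> \<bar>s\<bar> * (\<bar>b\<bar> + \<bar>t\<bar> + 1 + int i)"
        using s(1) by (intro mult_right_mono) auto
      then have fi: "f i > \<bar>t\<bar>"
        by (simp add: f_def)
      have "f i * 1 \<le> f i * (q n)\<^sup>2"
        using fi q_pos[OF \<open>n > 0\<close>] by (intro mult_left_mono) (auto simp: int_one_le_iff_zero_less)
      then show "t + f i * (q n)\<^sup>2 > 0"
        using fi by linarith
      have "even (f i) \<or> even (q n)"
        using s(2) dvd_trans by (auto simp: f_def b_def)
      then show "odd (t + f i * (q n)\<^sup>2)"
        using t by auto
    qed
    ultimately show "infinite {r::int. \<exists>(k::nat) (l::int) (x::int).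
          int k = t + r * (q n)\<^sup>2 \<and> k > 0 \<and> odd k \<and>
          of_int l = (of_int (q (n * k)) / of_int (q n) :: rat) \<and> l > 0 \<and>
          of_int x = (of_int \<epsilon> * ((of_int l - of_int t) / of_int ((q n)\<^sup>2)) :: rat) \<and>
          of_int x = (of_int \<epsilon> * ((of_int l - of_nat k) / of_int ((q n)\<^sup>2) + of_int r) :: rat) \<and>
          [x = c] (mod s)}"
      by (rule infinite_super[rotated])
  qed
qed

end
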